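(* Let $R=T/I$ be the ring defined in the context and let $\mathfrak{M}$ be its maximal ideal. Then $R$ is not atomic, while the polynomial ring $R[t]$ is strongly atomic. Moreover, if $f(t)\in R[t]$ is a nonzero nonunit polynomial, then the following hold (and exactly one of the three cases applies). (1) If $f(t)$ has at least one coefficient that is a unit of $R$, then $f(t)$ can be written as a product of no more than $n$ strong atoms of $R[t]$, where $n$ is the largest integer such that the coefficient of $t^n$ in $f(t)$ is a unit of $R$. (2) If $f(t)\in\mathfrak{M}[t]$ and $f(t)$ has a factorization $f(t)=g(t)h(t)$ with both $g(t),h(t)\in\mathfrak{M}[t]$, then $f(t)$ can be written as a product of two strong atoms of $R[t]$. (3) If $f(t)\in\mathfrak{M}[t]$ and $f(t)$ does not have a factorization $f(t)=g(t)h(t)$ with both $g(t),h(t)\in\mathfrak{M}[t]$, then $f(t)$ can be written as a product of no more than $\deg(f(t))+2$ strong atoms of $R[t]$.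
   Context: Construction of $R$. Let $p$ be a prime and let $\mathbb{F}$ be a perfect field of characteristic $p$. Let $x_1,x_2,\ldots,x_n,\ldots$ be countably infinitely many indeterminates and let $T=\mathbb{F}[x_1^{\alpha_1},x_2^{\alpha_2},\ldots,x_n^{\alpha_n},\ldots]$, where each exponent $\alpha_i$ ranges over all non-negative rational numbers; that is, $T$ is the monoid algebra over $\mathbb{F}$ of the additive monoid of finitely supported sequences of non-negative rationals, and its monomials are the products $\prod_i x_i^{\beta_i}$ with $\beta_i\in\mathbb{Q}_{\geq 0}$ and $\beta_i=0$ for all but finitely many $i$. Let $I$ be the ideal of $T$ generated by all monomials $\prod_i x_i^{\beta_i}$ with $\sum_i\beta_i>1$. Set $R=T/I$. Let $\mathfrak{M}$ be the maximal ideal of $R$ generated by the images of all $x_i^{\alpha}$ with $i\geq 1$ and $\alpha\in\mathbb{Q}$, $\alpha>0$. $\mathfrak{M}[t]$ denotes the set of polynomials in $R[t]$ all of whose coefficients lie in $\mathfrak{M}$. Definitions. Let $S$ be a commutative ring with identity. A nonunit $a\in S$ is an atom (irreducible) if whenever $a=bc$ with $b,c\in S$, then $(a)=(b)$ or $(a)=(c)$ as ideals. A nonunit $a\in S$ is a strong atom (strongly irreducible) if whenever $a=bc$ with $b,c\in S$, then $b$ or $c$ is a unit of $S$. The ring $S$ is atomic (respectively strongly atomic) if every nonzero nonunit of $S$ is a finite product of atoms (respectively strong atoms). *)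

theory Defs
  imports
    "HOL-Computational_Algebra.Computational_Algebra"
    "HOL-Library.Poly_Mapping"
begin

section \<open>Ideals, atoms and perfect fields\<close>

definition ideal_generated :: "'a::comm_ring_1 set \<Rightarrow> 'a set" where
  "ideal_generated S = module.span (*) S"

lemma module_times: "module ((*) :: 'a::comm_ring_1 \<Rightarrow> 'a \<Rightarrow> 'a)"
  by unfold_locales (simp_all add: algebra_simps)

lemma ideal_generated_zero: "0 \<in> ideal_generated S"
  unfolding ideal_generated_def by (rule module.span_zero[OF module_times])

lemma ideal_generated_add:
  "a \<in> ideal_generated S \<Longrightarrow> b \<in> ideal_generated S \<Longrightarrow> a + b \<in> ideal_generated S"
  unfolding ideal_generated_def by (rule module.span_add[OF module_times])

lemma ideal_generated_diff:
  "a \<in> ideal_generated S \<Longrightarrow> b \<in> ideal_generated S \<Longrightarrow> a - b \<in> ideal_generated S"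
  unfolding ideal_generated_def by (rule module.span_diff[OF module_times])

lemma ideal_generated_mult: "a \<in> ideal_generated S \<Longrightarrow> c * a \<in> ideal_generated S"
  unfolding ideal_generated_def by (rule module.span_scale[OF module_times])

lemma ideal_generated_minus: "a \<in> ideal_generated S \<Longrightarrow> - a \<in> ideal_generated S"
  using ideal_generated_diff[OF ideal_generated_zero, of a S] by simp

text \<open>Zero is not excluded by the next two definitions; in a ring with zero divisors it may or may
  not satisfy the first of them.  It never satisfies the second, since \<open>0 = 0 * 0\<close>.\<close>

definition atom :: "'a::comm_ring_1 \<Rightarrow> bool" where
  "atom a \<longleftrightarrow> \<not> a dvd 1 \<and>
     (\<forall>b c. a = b * c \<longrightarrow>
        ideal_generated {a} = ideal_generated {b} \<or> ideal_generated {a} = ideal_generated {c})"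

definition strong_atom :: "'a::comm_ring_1 \<Rightarrow> bool" where
  "strong_atom a \<longleftrightarrow> \<not> a dvd 1 \<and> (\<forall>b c. a = b * c \<longrightarrow> b dvd 1 \<or> c dvd 1)"

lemma strong_atom_iff_irreducible: "strong_atom (a::'a::comm_ring_1) \<longleftrightarrow> irreducible a"
  unfolding strong_atom_def irreducible_def using mult_zero_left[of "0::'a", symmetric]
  by (cases "a = 0") blast+

definition atomic :: "'a::comm_ring_1 itself \<Rightarrow> bool" where
  "atomic _ \<longleftrightarrow> (\<forall>a::'a. a \<noteq> 0 \<and> \<not> a dvd 1 \<longrightarrow>
     (\<exists>as. (\<forall>b\<in>set as. atom b) \<and> a = prod_list as))"

definition strongly_atomic :: "'a::comm_ring_1 itself \<Rightarrow> bool" where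
  "strongly_atomic _ \<longleftrightarrow> (\<forall>a::'a. a \<noteq> 0 \<and> \<not> a dvd 1 \<longrightarrow>
     (\<exists>as. (\<forall>b\<in>set as. strong_atom b) \<and> a = prod_list as))"

text \<open>Characteristic zero, or surjective Frobenius endomorphism.\<close>

definition perfect_field :: "'k::field itself \<Rightarrow> bool" where
  "perfect_field _ \<longleftrightarrow> CHAR('k) = 0 \<or> (\<forall>x::'k. \<exists>y. y ^ CHAR('k) = x)"


section \<open>Polynomials with non-negative rational exponents\<close>

typedef nonneg_rat = "{q::rat. 0 \<le> q}"
  morphisms rat_of_nonneg nonneg_of_rat
  by auto

setup_lifting type_definition_nonneg_rat

instantiation nonneg_rat :: cancel_comm_monoid_add
begin

lift_definition zero_nonneg_rat :: nonneg_rat is 0 by simp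

lift_definition plus_nonneg_rat :: "nonneg_rat \<Rightarrow> nonneg_rat \<Rightarrow> nonneg_rat" is "(+)" by simp

text \<open>Subtraction is truncated at zero, as on the natural numbers.\<close>

lift_definition minus_nonneg_rat :: "nonneg_rat \<Rightarrow> nonneg_rat \<Rightarrow> nonneg_rat"
  is "\<lambda>a b. max 0 (a - b)" by simp

instance
  by standard (transfer; simp add: algebra_simps max_def; fail)+

end

text \<open>The exponent vector of a monomial is a finitely supported function from the indices of the
  indeterminates to the exponents.  The indeterminates are numbered from zero.\<close>

type_synonym exponents = "nat \<Rightarrow>\<^sub>0 nonneg_rat"

type_synonym 'k ratexp_poly = "exponents \<Rightarrow>\<^sub>0 'k"

definition total_degree :: "exponents \<Rightarrow> rat" where
  "total_degree m = (\<Sum>i\<in>Poly_Mapping.keys m. rat_of_nonneg (Poly_Mapping.lookup m i))"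

definition monomial :: "exponents \<Rightarrow> 'k::field ratexp_poly" where
  "monomial m = Poly_Mapping.single m 1"

definition var_power :: "nat \<Rightarrow> nonneg_rat \<Rightarrow> 'k::field ratexp_poly" where
  "var_power i \<alpha> = monomial (Poly_Mapping.single i \<alpha>)"

definition high_degree_ideal :: "'k::field ratexp_poly set" where
  "high_degree_ideal = ideal_generated {monomial m | m. total_degree m > 1}"

lemma nonneg_rat_add_eq_0: "a + b = (0 :: nonneg_rat) \<Longrightarrow> b = 0"
  by transfer linarith

lemma exponents_add_eq_0:
  assumes "a + b = (0 :: exponents)"
  shows "b = 0"
proof (rule poly_mapping_eqI)
  fix i
  have "Poly_Mapping.lookup a i + Poly_Mapping.lookup b i = 0"
    using arg_cong[OF assms, of "\<lambda>m. Poly_Mapping.lookup m i"] by (simp add: lookup_add)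
  then show "Poly_Mapping.lookup b i = Poly_Mapping.lookup 0 i"
    using nonneg_rat_add_eq_0 by simp
qed

lemma one_notin_high_degree_ideal: "(1 :: 'k::field ratexp_poly) \<notin> high_degree_ideal"
proof
  have *: "Poly_Mapping.lookup f 0 = 0" if "f \<in> high_degree_ideal" for f :: "'k ratexp_poly"
    using that unfolding high_degree_ideal_def ideal_generated_def
  proof (induction f rule: module.span_induct_alt[OF module_times, consumes 1])
    case 1
    then show ?case by simp
  next
    case (2 c x y)
    then obtain m where x: "x = monomial m" and m: "total_degree m > 1"
      by blast
    from m have "m \<noteq> 0" by (auto simp: total_degree_def)
    have "0 \<notin> Poly_Mapping.keys (c * x)"
    proof
      assume "0 \<in> Poly_Mapping.keys (c * x)"
      then obtain a where "0 = a + m"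
        using keys_mult[of c x] by (auto simp: x monomial_def)
      then show False
        using exponents_add_eq_0[of a m] \<open>m \<noteq> 0\<close> by simp
    qed
    then show ?case
      using 2 by (simp add: lookup_add in_keys_iff)
  qed
  assume "(1 :: 'k ratexp_poly) \<in> high_degree_ideal"
  from *[OF this] show False by simp
qed


section \<open>The quotient ring and its maximal ideal\<close>

quotient_type (overloaded) 'k trunc_ring =
  "'k::field ratexp_poly" / "\<lambda>a b. a - b \<in> high_degree_ideal"
  morphisms rep_trunc trunc_of
proof (rule equivpI)
  show "reflp (\<lambda>a b :: 'k ratexp_poly. a - b \<in> high_degree_ideal)"
    unfolding high_degree_ideal_def by (intro reflpI) (simp add: ideal_generated_zero)
  show "symp (\<lambda>a b :: 'k ratexp_poly. a - b \<in> high_degree_ideal)"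
  proof (rule sympI)
    fix a b :: "'k ratexp_poly"
    assume "a - b \<in> high_degree_ideal"
    then have "- (a - b) \<in> high_degree_ideal"
      unfolding high_degree_ideal_def by (rule ideal_generated_minus)
    then show "b - a \<in> high_degree_ideal"
      by simp
  qed
  show "transp (\<lambda>a b :: 'k ratexp_poly. a - b \<in> high_degree_ideal)"
  proof (rule transpI)
    fix a b c :: "'k ratexp_poly"
    assume "a - b \<in> high_degree_ideal" "b - c \<in> high_degree_ideal"
    then have "(a - b) + (b - c) \<in> high_degree_ideal"
      unfolding high_degree_ideal_def by (rule ideal_generated_add)
    then show "a - c \<in> high_degree_ideal"
      by simp
  qed
qed

instantiation trunc_ring :: (field) comm_ring_1
begin

lift_definition zero_trunc_ring :: "'a trunc_ring" is 0 .

lift_definition one_trunc_ring :: "'a trunc_ring" is 1 .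

lift_definition plus_trunc_ring :: "'a trunc_ring \<Rightarrow> 'a trunc_ring \<Rightarrow> 'a trunc_ring" is "(+)"
proof -
  fix a a' b b' :: "'a ratexp_poly"
  assume "a - a' \<in> high_degree_ideal" "b - b' \<in> high_degree_ideal"
  then have "(a - a') + (b - b') \<in> high_degree_ideal"
    unfolding high_degree_ideal_def by (rule ideal_generated_add)
  then show "a + b - (a' + b') \<in> high_degree_ideal"
    by (simp add: algebra_simps)
qed

lift_definition minus_trunc_ring :: "'a trunc_ring \<Rightarrow> 'a trunc_ring \<Rightarrow> 'a trunc_ring" is "(-)"
proof -
  fix a a' b b' :: "'a ratexp_poly"
  assume "a - a' \<in> high_degree_ideal" "b - b' \<in> high_degree_ideal"
  then have "(a - a') - (b - b') \<in> high_degree_ideal"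
    unfolding high_degree_ideal_def by (rule ideal_generated_diff)
  then show "a - b - (a' - b') \<in> high_degree_ideal"
    by (simp add: algebra_simps)
qed

lift_definition uminus_trunc_ring :: "'a trunc_ring \<Rightarrow> 'a trunc_ring" is uminus
proof -
  fix a a' :: "'a ratexp_poly"
  assume "a - a' \<in> high_degree_ideal"
  then have "- (a - a') \<in> high_degree_ideal"
    unfolding high_degree_ideal_def by (rule ideal_generated_minus)
  then show "- a - - a' \<in> high_degree_ideal"
    by (simp add: algebra_simps)
qed

lift_definition times_trunc_ring :: "'a trunc_ring \<Rightarrow> 'a trunc_ring \<Rightarrow> 'a trunc_ring" is "(*)"
proof -
  fix a a' b b' :: "'a ratexp_poly"
  assume "a - a' \<in> high_degree_ideal" "b - b' \<in> high_degree_ideal"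
  then have "b * (a - a') + a' * (b - b') \<in> high_degree_ideal"
    unfolding high_degree_ideal_def by (intro ideal_generated_add ideal_generated_mult)
  then show "a * b - a' * b' \<in> high_degree_ideal"
    by (simp add: algebra_simps)
qed

instance
proof
  show "(0 :: 'a trunc_ring) \<noteq> 1"
  proof transfer
    show "(0 :: 'a ratexp_poly) - 1 \<notin> high_degree_ideal"
      using one_notin_high_degree_ideal ideal_generated_minus[of "0 - 1"]
      unfolding high_degree_ideal_def by auto
  qed
qed (transfer; simp add: algebra_simps high_degree_ideal_def ideal_generated_zero; fail)+

end

definition max_ideal :: "'k::field trunc_ring set" where
  "max_ideal = ideal_generated {trunc_of (var_power i \<alpha>) | i \<alpha>. 0 < rat_of_nonneg \<alpha>}"

definition max_ideal_poly :: "'k::field trunc_ring poly set" where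
  "max_ideal_poly = {f. \<forall>n. coeff f n \<in> max_ideal}"

definition has_unit_coeff :: "'k::field trunc_ring poly \<Rightarrow> bool" where
  "has_unit_coeff f \<longleftrightarrow> (\<exists>n. coeff f n dvd 1)"

lemma finite_unit_coeffs: "finite {n. coeff f n dvd 1}"
  for f :: "'k::field trunc_ring poly"
  by (rule finite_subset[of _ "{..degree f}"]) (auto intro!: le_degree)

definition factors_in_max_ideal_poly :: "'k::field trunc_ring poly \<Rightarrow> bool" where
  "factors_in_max_ideal_poly f \<longleftrightarrow> (\<exists>g\<in>max_ideal_poly. \<exists>h\<in>max_ideal_poly. f = g * h)"

end

theory Submission
  imports Defs
begin

text \<open>
  Write \<open>R\<close> for the truncated ring, \<open>M\<close> for its maximal ideal and \<open>T\<close> for the ring of polynomials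
  with rational exponents that \<open>R\<close> is a quotient of.

  \<open>R\<close> is not atomic.  Exponents can be divided by \<open>p\<close> and coefficients have \<open>p\<close>-th roots, so by
  additivity of the Frobenius map every element of \<open>M\<close> is a \<open>p\<close>-th power of an element of \<open>M\<close>
  (\<open>max_ideal_power_root\<close>).  Hence every nonzero nonunit is a product of two elements of \<open>M\<close>, and in a
  local ring a nonzero product \<open>b * c\<close> of two nonunits is associated to neither \<open>b\<close> nor \<open>c\<close>.

  All statements about \<open>R[t]\<close> rest on comparing lowest homogeneous components.  An element of \<open>R\<close> is
  determined by its homogeneous components of degree at most 1, and up to that degree the
  multiplication of \<open>R\<close> agrees with that of the domain \<open>T\<close>.  So, as long as the degrees add up to at
  most 1, the lowest component of a product in \<open>R[t]\<close> is the product in \<open>T[t]\<close> of the lowest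
  components (\<open>component_mult\<close>).  In degree 0 this is reduction modulo \<open>M\<close>, and since \<open>M\<close> consists of
  nilpotent elements, a polynomial is a unit precisely if its reduction is a nonzero constant
  (\<open>poly_unit_iff\<close>).

  If some coefficient of \<open>f\<close> is a unit, the degree of the reduction of \<open>f\<close> is the largest index \<open>n\<close> of
  such a coefficient.  It is additive and positive on nonunit factors, so \<open>f\<close> can be split at most
  \<open>n - 1\<close> times.

  If \<open>f = g * h\<close> with \<open>g\<close> and \<open>h\<close> in \<open>M[t]\<close>, take two variables \<open>y\<close> and \<open>z\<close> that occur in neither
  factor and put \<open>u = y + z t\<close>.  Since \<open>u\<close> is homogeneous of the top degree 1, it annihilates \<open>M[t]\<close>,
  so that \<open>f = (g + u) * (h + u)\<close>.  Setting all other variables to zero turns \<open>g + u\<close> into \<open>u\<close>, and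
  \<open>u\<close> does not factor nontrivially: the lowest components of two factors would multiply to \<open>y + z t\<close>
  in \<open>T[t]\<close>, so one of them would be free of \<open>t\<close> and divide both \<open>y\<close> and \<open>z\<close>, hence be a scalar
  (\<open>strong_atom_add_fresh_linear\<close>).

  In the remaining case every factorization of \<open>f\<close> has exactly one factor with vanishing reduction.
  Write \<open>f = g * h\<close> where the reduction of \<open>h\<close> has the largest possible degree; this maximum exists
  and is at most the degree of \<open>f\<close>, as one sees on the lowest component of \<open>g\<close>.  By maximality \<open>g\<close> is a
  strong atom, and \<open>h\<close> is covered by the first case.
\<close>


section \<open>Exponents and total degree\<close>

text \<open>Ordered exponents induce the lexicographic order on exponent vectors, and with it the ring of
  polynomials with rational exponents becomes an instance of \<open>idom\<close>.\<close>

instantiation nonneg_rat :: linorder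
begin

lift_definition less_eq_nonneg_rat :: "nonneg_rat \<Rightarrow> nonneg_rat \<Rightarrow> bool" is "(\<le>)" .

lift_definition less_nonneg_rat :: "nonneg_rat \<Rightarrow> nonneg_rat \<Rightarrow> bool" is "(<)" .

instance
  by standard (transfer; linarith)+

end

instance nonneg_rat :: "{ordered_comm_monoid_add, ordered_ab_semigroup_add_imp_le}"
  by standard (transfer; linarith)+

lemmas rat_of_nonneg_simps [simp] =
  zero_nonneg_rat.rep_eq plus_nonneg_rat.rep_eq

lemma rat_of_nonneg_nonneg [simp]: "0 \<le> rat_of_nonneg a"
  using rat_of_nonneg[of a] by simp

lemma rat_of_nonneg_eq_0_iff [simp]: "rat_of_nonneg a = 0 \<longleftrightarrow> a = 0"
  by transfer simp

lemma rat_of_nonneg_one [simp]: "rat_of_nonneg (nonneg_of_rat 1) = 1"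
  by (simp add: nonneg_of_rat_inverse)

lemma nonneg_of_rat_one_nonzero [simp]: "nonneg_of_rat 1 \<noteq> 0"
  by (simp flip: rat_of_nonneg_eq_0_iff)

lemma total_degree_superset:
  assumes "finite S" "Poly_Mapping.keys m \<subseteq> S"
  shows "total_degree m = (\<Sum>i\<in>S. rat_of_nonneg (Poly_Mapping.lookup m i))"
  unfolding total_degree_def using assms
  by (intro sum.mono_neutral_left) (auto simp: in_keys_iff)

lemma total_degree_add [simp]: "total_degree (a + b) = total_degree a + total_degree b"
proof -
  let ?S = "Poly_Mapping.keys a \<union> Poly_Mapping.keys b"
  have "Poly_Mapping.keys (a + b) \<subseteq> ?S" by (rule keys_add)
  then show ?thesis
    by (simp add: total_degree_superset[of ?S] lookup_add sum.distrib)
qed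

lemma total_degree_nonneg [simp]: "0 \<le> total_degree m"
  unfolding total_degree_def by (intro sum_nonneg) simp

lemma total_degree_eq_0_iff [simp]: "total_degree m = 0 \<longleftrightarrow> m = 0"
proof
  assume "total_degree m = 0"
  then have "\<forall>i\<in>Poly_Mapping.keys m. rat_of_nonneg (Poly_Mapping.lookup m i) = 0"
    unfolding total_degree_def by (subst (asm) sum_nonneg_eq_0_iff) auto
  then have "Poly_Mapping.lookup m i = Poly_Mapping.lookup 0 i" for i
    by (cases "i \<in> Poly_Mapping.keys m") (auto simp: in_keys_iff)
  then show "m = 0" by (rule poly_mapping_eqI)
qed (simp add: total_degree_def)

lemma total_degree_pos: "m \<noteq> 0 \<Longrightarrow> 0 < total_degree m"
  by (metis total_degree_eq_0_iff total_degree_nonneg order_less_le)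

lemma total_degree_zero [simp]: "total_degree 0 = 0"
  by simp

lemma total_degree_single [simp]: "total_degree (Poly_Mapping.single i a) = rat_of_nonneg a"
  by (simp add: total_degree_def)

abbreviation unit_exponent :: "nat \<Rightarrow> exponents" where
  "unit_exponent i \<equiv> Poly_Mapping.single i (nonneg_of_rat 1)"

lemma keys_exponents_add:
  "Poly_Mapping.keys (a + b :: exponents) = Poly_Mapping.keys a \<union> Poly_Mapping.keys b"
proof -
  have "a + b = 0 \<longleftrightarrow> a = 0 \<and> b = 0" for a b :: nonneg_rat
    using nonneg_rat_add_eq_0[of a b] nonneg_rat_add_eq_0[of b a] by (auto simp: add.commute)
  then show ?thesis by (auto simp: in_keys_iff lookup_add)
qed


section \<open>Restricting the support of a finitely supported function\<close>

lift_definition restrict_keys :: "'a set \<Rightarrow> ('a \<Rightarrow>\<^sub>0 'b::zero) \<Rightarrow> ('a \<Rightarrow>\<^sub>0 'b)"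
  is "\<lambda>A f k. f k when k \<in> A"
  by (rule finite_subset[rotated]) auto

lemma lookup_restrict_keys: "Poly_Mapping.lookup (restrict_keys A f) k = (Poly_Mapping.lookup f k when k \<in> A)"
  by transfer simp

lemma keys_restrict_keys: "Poly_Mapping.keys (restrict_keys A f) = Poly_Mapping.keys f \<inter> A"
  by (auto simp: in_keys_iff lookup_restrict_keys)

lemma restrict_keys_zero [simp]: "restrict_keys A 0 = 0"
  by (rule poly_mapping_eqI) (simp add: lookup_restrict_keys)

lemma restrict_keys_add: "restrict_keys A (f + g) = restrict_keys A f + restrict_keys A g"
  by (rule poly_mapping_eqI) (simp add: lookup_restrict_keys lookup_add when_add_distrib)

lemma restrict_keys_diff:
  "restrict_keys A (f - g) = restrict_keys A f - restrict_keys A (g :: 'a \<Rightarrow>\<^sub>0 'b::ab_group_add)"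
  by (rule poly_mapping_eqI) (simp add: lookup_restrict_keys lookup_minus when_def)

lemma restrict_keys_sum: "restrict_keys A (\<Sum>i\<in>S. f i) = (\<Sum>i\<in>S. restrict_keys A (f i))"
  by (induction S rule: infinite_finite_induct) (simp_all add: restrict_keys_add)

lemma restrict_keys_single:
  "restrict_keys A (Poly_Mapping.single k c) = (if k \<in> A then Poly_Mapping.single k c else 0)"
  by (rule poly_mapping_eqI) (simp add: lookup_restrict_keys lookup_single when_def)

lemma single_eq_0_iff [simp]: "Poly_Mapping.single k c = 0 \<longleftrightarrow> c = 0"
  by (metis lookup_single_eq lookup_zero single_zero)

lemma restrict_keys_restrict_keys: "restrict_keys A (restrict_keys B f) = restrict_keys (A \<inter> B) f"
  by (rule poly_mapping_eqI) (simp add: lookup_restrict_keys when_def)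

lemma restrict_keys_eq_self: "Poly_Mapping.keys f \<subseteq> A \<Longrightarrow> restrict_keys A f = f"
  by (rule poly_mapping_eqI) (auto simp: lookup_restrict_keys when_def in_keys_iff)

lemma sum_single_keys: "(\<Sum>k\<in>Poly_Mapping.keys f. Poly_Mapping.single k (Poly_Mapping.lookup f k)) = f"
  by (rule poly_mapping_eqI) (auto simp: lookup_sum lookup_single when_def in_keys_iff)

text \<open>This is the common core of all arguments with components of products: if membership of a sum of
  two exponents in \<open>C\<close> decouples, passing to parts is multiplicative.\<close>

lemma restrict_keys_mult:
  fixes f g :: "'a::monoid_add \<Rightarrow>\<^sub>0 'b::semiring_0"
  assumes "\<And>k l. k \<in> Poly_Mapping.keys f \<Longrightarrow> l \<in> Poly_Mapping.keys g \<Longrightarrow> k + l \<in> C \<longleftrightarrow> k \<in> A \<and> l \<in> B"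
  shows "restrict_keys C (f * g) = restrict_keys A f * restrict_keys B g"
proof -
  let ?f = "\<lambda>k. Poly_Mapping.single k (Poly_Mapping.lookup f k)"
  let ?g = "\<lambda>l. Poly_Mapping.single l (Poly_Mapping.lookup g l)"
  have "restrict_keys C (f * g) =
      restrict_keys C ((\<Sum>k\<in>Poly_Mapping.keys f. ?f k) * (\<Sum>l\<in>Poly_Mapping.keys g. ?g l))"
    by (simp only: sum_single_keys)
  also have "\<dots> = (\<Sum>k\<in>Poly_Mapping.keys f. \<Sum>l\<in>Poly_Mapping.keys g. restrict_keys C (?f k * ?g l))"
    by (simp add: sum_product restrict_keys_sum)
  also have "\<dots> = (\<Sum>k\<in>Poly_Mapping.keys f. \<Sum>l\<in>Poly_Mapping.keys g.
      restrict_keys A (?f k) * restrict_keys B (?g l))"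
    by (intro sum.cong refl) (auto simp: mult_single restrict_keys_single assms)
  also have "\<dots> = restrict_keys A (\<Sum>k\<in>Poly_Mapping.keys f. ?f k) * restrict_keys B (\<Sum>l\<in>Poly_Mapping.keys g. ?g l)"
    by (simp add: sum_product restrict_keys_sum)
  finally show ?thesis by (simp only: sum_single_keys)
qed


section \<open>Canonical representatives\<close>

lemma high_degree_ideal_eq:
  "high_degree_ideal = {f :: 'k::field ratexp_poly. \<forall>m\<in>Poly_Mapping.keys f. total_degree m > 1}"
proof (intro equalityI subsetI CollectI)
  fix f :: "'k ratexp_poly"
  assume "f \<in> high_degree_ideal"
  then show "\<forall>m\<in>Poly_Mapping.keys f. total_degree m > 1"
    unfolding high_degree_ideal_def ideal_generated_def
  proof (induction f rule: module.span_induct_alt[OF module_times, consumes 1])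
    case (2 c x y)
    then obtain m where x: "x = monomial m" and m: "total_degree m > 1"
      by blast
    have "total_degree n > 1" if n: "n \<in> Poly_Mapping.keys (c * x)" for n
    proof -
      obtain a where "n = a + m"
        using keys_mult[of c x] n by (auto simp: x monomial_def)
      then have "total_degree n = total_degree a + total_degree m" by simp
      then show ?thesis using m total_degree_nonneg[of a] by linarith
    qed
    then show ?case
      using 2 keys_add[of "c * x" y] by blast
  qed simp
next
  fix f :: "'k ratexp_poly"
  assume "f \<in> {f. \<forall>m\<in>Poly_Mapping.keys f. total_degree m > 1}"
  then have f: "\<And>m. m \<in> Poly_Mapping.keys f \<Longrightarrow> total_degree m > 1" by blast
  have "(\<Sum>k\<in>Poly_Mapping.keys f. Poly_Mapping.single k (Poly_Mapping.lookup f k)) \<in> high_degree_ideal"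
    unfolding high_degree_ideal_def ideal_generated_def
  proof (rule module.span_sum[OF module_times])
    fix m assume m: "m \<in> Poly_Mapping.keys f"
    have "Poly_Mapping.single m (Poly_Mapping.lookup f m) =
        Poly_Mapping.single 0 (Poly_Mapping.lookup f m) * monomial m"
      by (simp add: monomial_def mult_single)
    also have "\<dots> \<in> module.span (*) {monomial m |m. 1 < total_degree m}"
      using f[OF m] by (intro module.span_scale[OF module_times] module.span_base[OF module_times]) auto
    finally show "Poly_Mapping.single m (Poly_Mapping.lookup f m) \<in> module.span (*) {monomial m |m. 1 < total_degree m}" .
  qed
  then show "f \<in> high_degree_ideal" by (simp only: sum_single_keys)
qed

text \<open>The representative without monomials of degree above 1.  It gives access to the coefficients of
  an element of the quotient.\<close>

lift_definition canonical :: "'k::field trunc_ring \<Rightarrow> 'k ratexp_poly"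
  is "restrict_keys {m. total_degree m \<le> 1}"
proof -
  fix f g :: "'k ratexp_poly"
  assume "f - g \<in> high_degree_ideal"
  then have "restrict_keys {m. total_degree m \<le> 1} (f - g) = 0"
    by (auto simp: high_degree_ideal_eq keys_restrict_keys simp flip: keys_eq_empty)
  then show "restrict_keys {m. total_degree m \<le> 1} f = restrict_keys {m. total_degree m \<le> 1} g"
    by (simp add: restrict_keys_diff)
qed

lemma canonical_trunc_of: "canonical (trunc_of f) = restrict_keys {m. total_degree m \<le> 1} f"
  by (simp add: canonical.abs_eq)

lemma keys_canonical: "m \<in> Poly_Mapping.keys (canonical a) \<Longrightarrow> total_degree m \<le> 1"
  by transfer (auto simp: keys_restrict_keys)

lemma trunc_of_canonical [simp]: "trunc_of (canonical a) = a"
proof transfer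
  fix f :: "'a ratexp_poly"
  show "restrict_keys {m. total_degree m \<le> 1} f - f \<in> high_degree_ideal"
    by (auto simp: high_degree_ideal_eq in_keys_iff lookup_minus lookup_restrict_keys when_def split: if_splits)
qed

lemma canonical_inject: "canonical a = canonical b \<longleftrightarrow> a = b"
  by (metis trunc_of_canonical)

lemma canonical_zero [simp]: "canonical 0 = 0"
  by transfer simp

lemma canonical_eq_0_iff [simp]: "canonical a = 0 \<longleftrightarrow> a = 0"
  using canonical_inject[of a 0] by simp

lemma canonical_one [simp]: "canonical 1 = 1"
  by transfer (rule restrict_keys_eq_self, simp)

lemma canonical_add: "canonical (a + b) = canonical a + canonical b"
  by transfer (rule restrict_keys_add)

lemma canonical_diff: "canonical (a - b) = canonical a - canonical b"
  by transfer (rule restrict_keys_diff)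

lemma canonical_sum: "canonical (\<Sum>i\<in>S. f i) = (\<Sum>i\<in>S. canonical (f i))"
  by (induction S rule: infinite_finite_induct) (simp_all add: canonical_add)

lemma canonical_mult:
  "canonical (a * b) = restrict_keys {m. total_degree m \<le> 1} (canonical a * canonical b)"
  by (metis canonical_trunc_of trunc_of_canonical times_trunc_ring.abs_eq)

lemma trunc_of_sum: "trunc_of (\<Sum>i\<in>S. f i) = (\<Sum>i\<in>S. trunc_of (f i))"
  by (induction S rule: infinite_finite_induct)
    (simp_all add: zero_trunc_ring.abs_eq plus_trunc_ring.abs_eq[symmetric])

abbreviation scaled_monomial :: "exponents \<Rightarrow> 'k::field \<Rightarrow> 'k trunc_ring" where
  "scaled_monomial m c \<equiv> trunc_of (Poly_Mapping.single m c)"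

lemma sum_scaled_monomials:
  "(\<Sum>m\<in>Poly_Mapping.keys (canonical a). scaled_monomial m (Poly_Mapping.lookup (canonical a) m)) = a"
  by (simp add: sum_single_keys flip: trunc_of_sum)

lemma scaled_monomial_mult:
  "scaled_monomial m c * scaled_monomial n d = scaled_monomial (m + n) (c * d)"
  by (simp add: times_trunc_ring.abs_eq mult_single)

lemma scaled_monomial_eq_0: "total_degree m > 1 \<Longrightarrow> scaled_monomial m c = 0"
  by (simp add: canonical_trunc_of restrict_keys_single flip: canonical_eq_0_iff)

lemma canonical_scaled_monomial:
  "total_degree m \<le> 1 \<Longrightarrow> canonical (scaled_monomial m c) = Poly_Mapping.single m c"
  by (simp add: canonical_trunc_of restrict_keys_single)


section \<open>The maximal ideal and the units\<close>

definition residue :: "'k::field trunc_ring \<Rightarrow> 'k" where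
  "residue a = Poly_Mapping.lookup (canonical a) 0"

lemma residue_zero [simp]: "residue 0 = 0" and residue_one [simp]: "residue 1 = 1"
  by (simp_all add: residue_def)

lemma residue_add [simp]: "residue (a + b) = residue a + residue b"
  and residue_diff [simp]: "residue (a - b) = residue a - residue b"
  by (simp_all add: residue_def canonical_add canonical_diff lookup_add lookup_minus)

lemma residue_scaled_monomial: "residue (scaled_monomial m c) = (if m = 0 then c else 0)"
  by (auto simp: residue_def canonical_trunc_of lookup_restrict_keys lookup_single when_def)

lemma residue_mult [simp]: "residue (a * b) = residue a * residue b"
proof -
  have single: "restrict_keys {0} f = Poly_Mapping.single 0 (Poly_Mapping.lookup f 0)" for f :: "'a ratexp_poly"
    by (rule poly_mapping_eqI) (simp add: lookup_restrict_keys lookup_single when_def)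
  have "restrict_keys {0} (canonical (a * b)) = restrict_keys {0} (canonical a * canonical b)"
    by (simp add: canonical_mult restrict_keys_restrict_keys)
  also have "\<dots> = restrict_keys {0} (canonical a) * restrict_keys {0} (canonical b)"
    using exponents_add_eq_0 by (intro restrict_keys_mult) (auto simp: add.commute)
  finally have "Poly_Mapping.single (0::exponents) (residue (a * b)) = Poly_Mapping.single 0 (residue a * residue b)"
    by (simp add: single residue_def mult_single)
  then show ?thesis by (metis lookup_single_eq)
qed

lemma scaled_monomial_in_max_ideal:
  assumes "m \<noteq> 0"
  shows "scaled_monomial m c \<in> max_ideal"
proof -
  from assms obtain i where i: "i \<in> Poly_Mapping.keys m" by (meson all_not_in_conv keys_eq_empty)
  let ?\<alpha> = "Poly_Mapping.lookup m i"
  have "rat_of_nonneg ?\<alpha> \<noteq> 0" using i by (simp add: in_keys_iff)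
  then have pos: "0 < rat_of_nonneg ?\<alpha>" using rat_of_nonneg_nonneg order_less_le by metis
  have "(m - Poly_Mapping.single i ?\<alpha>) + Poly_Mapping.single i ?\<alpha> = m"
    by (rule poly_mapping_eqI) (simp add: lookup_add lookup_minus lookup_single when_def)
  then have "scaled_monomial m c = scaled_monomial (m - Poly_Mapping.single i ?\<alpha>) c * trunc_of (var_power i ?\<alpha>)"
    by (simp add: var_power_def monomial_def scaled_monomial_mult)
  also have "\<dots> \<in> max_ideal"
    unfolding max_ideal_def using pos
    by (intro ideal_generated_mult) (auto simp: ideal_generated_def intro!: module.span_base[OF module_times])
  finally show ?thesis .
qed

text \<open>The kernel of the residue map is an ideal that contains the generators, and conversely every
  non-constant monomial is a multiple of one of the generators.\<close>

lemma max_ideal_iff_residue: "a \<in> max_ideal \<longleftrightarrow> residue a = 0"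
proof
  assume "a \<in> max_ideal"
  then show "residue a = 0"
    unfolding max_ideal_def ideal_generated_def
  proof (induction a rule: module.span_induct_alt[OF module_times, consumes 1])
    case (2 c x y)
    then obtain i \<alpha> where x: "x = trunc_of (var_power i \<alpha>)" and pos: "0 < rat_of_nonneg \<alpha>"
      by blast
    from pos have "total_degree (Poly_Mapping.single i \<alpha>) \<noteq> 0"
      by (simp only: total_degree_single)
    then have "residue x = 0"
      by (simp add: x var_power_def monomial_def residue_scaled_monomial del: total_degree_single)
    with 2 show ?case by simp
  qed simp
next
  assume a: "residue a = 0"
  have "(\<Sum>m\<in>Poly_Mapping.keys (canonical a). scaled_monomial m (Poly_Mapping.lookup (canonical a) m)) \<in> max_ideal"
    unfolding max_ideal_def ideal_generated_def
  proof (rule module.span_sum[OF module_times])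
    fix m assume "m \<in> Poly_Mapping.keys (canonical a)"
    then have "m \<noteq> 0" using a by (auto simp: residue_def in_keys_iff)
    then show "scaled_monomial m (Poly_Mapping.lookup (canonical a) m)
        \<in> module.span (*) {trunc_of (var_power i \<alpha>) |i \<alpha>. 0 < rat_of_nonneg \<alpha>}"
      using scaled_monomial_in_max_ideal unfolding max_ideal_def ideal_generated_def by blast
  qed
  then show "a \<in> max_ideal" by (simp only: sum_scaled_monomials)
qed

lemma max_ideal_poly_iff_residue: "f \<in> max_ideal_poly \<longleftrightarrow> (\<forall>i. residue (coeff f i) = 0)"
  by (simp add: max_ideal_poly_def max_ideal_iff_residue)

text \<open>The sum \<open>u + a\<close> divides \<open>u ^ n - (- a) ^ n\<close>, which is the unit \<open>u ^ n\<close>.\<close>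

lemma unit_add_nilpotent:
  fixes u a :: "'a::comm_ring_1"
  assumes "u dvd 1" "a ^ n = 0"
  shows "u + a dvd 1"
proof -
  have "(- a) ^ n = 0" by (subst power_minus) (simp add: assms)
  then have "u ^ n = u ^ n - (- a) ^ n" by simp
  also have "\<dots> = (u - (- a)) * (\<Sum>i<n. (- a) ^ (n - Suc i) * u ^ i)"
    by (rule power_diff_sumr2)
  finally have "u + a dvd u ^ n" by simp
  moreover have "u ^ n dvd 1" using dvd_power_same[OF assms(1), of n] by simp
  ultimately show ?thesis by (rule dvd_trans)
qed

lemma scaled_monomial_power:
  "\<exists>m'. scaled_monomial m c ^ n = scaled_monomial m' (c ^ n) \<and> total_degree m' = of_nat n * total_degree m"
proof (induction n)
  case 0
  show ?case by (rule exI[of _ 0]) (simp add: one_trunc_ring.abs_eq)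
next
  case (Suc n)
  then obtain m' where "scaled_monomial m c ^ n = scaled_monomial m' (c ^ n)"
    "total_degree m' = of_nat n * total_degree m" by blast
  then show ?case
    by (intro exI[of _ "m + m'"]) (simp add: scaled_monomial_mult algebra_simps)
qed

lemma scaled_monomial_nilpotent:
  assumes "m \<noteq> 0"
  shows "\<exists>n. scaled_monomial m c ^ n = 0"
proof -
  have "total_degree m > 0" using assms by (rule total_degree_pos)
  then obtain n where n: "1 < of_nat n * total_degree m" using ex_less_of_nat_mult by blast
  obtain m' where "scaled_monomial m c ^ n = scaled_monomial m' (c ^ n)" "total_degree m' = of_nat n * total_degree m"
    using scaled_monomial_power by blast
  then have "scaled_monomial m c ^ n = 0" using scaled_monomial_eq_0[of m' "c ^ n"] n by simp
  then show ?thesis ..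
qed

text \<open>Monomials of positive degree are nilpotent, so adding them one at a time keeps a unit a unit.\<close>

lemma unit_add_monom:
  assumes "a \<in> max_ideal" "u dvd 1"
  shows "u + monom a i dvd 1"
proof -
  define t where "t m = scaled_monomial m (Poly_Mapping.lookup (canonical a) m)" for m
  have "u + monom (\<Sum>m\<in>S. t m) i dvd 1" if "finite S" "0 \<notin> S" for S
    using that
  proof (induction S rule: finite_induct)
    case (insert m S)
    then have "m \<noteq> 0" by auto
    then obtain n where "t m ^ n = 0"
      using scaled_monomial_nilpotent[of m "Poly_Mapping.lookup (canonical a) m"] by (auto simp: t_def)
    then have "monom (t m) i ^ n = 0" by (simp add: monom_power)
    then have "(u + monom (\<Sum>m\<in>S. t m) i) + monom (t m) i dvd 1"
      using insert unit_add_nilpotent[of "u + monom (\<Sum>m\<in>S. t m) i"] by blast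
    moreover have "u + monom (\<Sum>m\<in>insert m S. t m) i = (u + monom (\<Sum>m\<in>S. t m) i) + monom (t m) i"
      using insert.hyps by (simp add: add_monom add.assoc add.commute)
    ultimately show ?case by (simp add: add.assoc)
  qed (use assms in simp)
  moreover have "0 \<notin> Poly_Mapping.keys (canonical a)"
    using assms by (simp add: max_ideal_iff_residue residue_def in_keys_iff)
  ultimately have "u + monom (\<Sum>m\<in>Poly_Mapping.keys (canonical a). t m) i dvd 1" by simp
  then show ?thesis by (simp add: t_def sum_scaled_monomials)
qed

lemma unit_add_max_ideal_poly:
  assumes "f \<in> max_ideal_poly" "u dvd 1"
  shows "u + f dvd 1"
proof -
  have "u + (\<Sum>i\<in>S. monom (coeff f i) i) dvd 1" if "finite S" for S
    using that
  proof (induction S rule: finite_induct)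
    case (insert i S)
    then have "(u + (\<Sum>i\<in>S. monom (coeff f i) i)) + monom (coeff f i) i dvd 1"
      using assms by (intro unit_add_monom) (auto simp: max_ideal_poly_def)
    then show ?case using insert by (simp add: algebra_simps)
  qed (use assms in simp)
  from this[of "{..degree f}"] show ?thesis by (simp add: poly_as_sum_of_monoms)
qed

lemma poly_unitI:
  assumes "residue (coeff f 0) \<noteq> 0" "\<And>i. i > 0 \<Longrightarrow> residue (coeff f i) = 0"
  shows "f dvd 1"
proof -
  define c where "c = residue (coeff f 0)"
  let ?u = "[:scaled_monomial 0 c:]"
  have "c \<noteq> 0" using assms(1) by (simp add: c_def)
  then have "scaled_monomial 0 c * scaled_monomial 0 (inverse c) = 1"
    by (simp add: scaled_monomial_mult one_trunc_ring.abs_eq)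
  then have "?u * [:scaled_monomial 0 (inverse c):] = 1" by (simp add: one_pCons mult.commute)
  then have "?u dvd 1" by (metis dvdI)
  moreover have "f - ?u \<in> max_ideal_poly"
    using assms by (auto simp: max_ideal_poly_iff_residue residue_scaled_monomial c_def coeff_pCons split: nat.split)
  ultimately have "?u + (f - ?u) dvd 1" by (intro unit_add_max_ideal_poly)
  then show ?thesis by simp
qed

lemma unit_iff_residue: "a dvd 1 \<longleftrightarrow> residue a \<noteq> 0"
proof
  assume "a dvd 1"
  then obtain b where "1 = a * b" by (elim dvdE)
  then have "residue 1 = residue a * residue b" by (metis residue_mult)
  then show "residue a \<noteq> 0" by auto
next
  assume "residue a \<noteq> 0"
  then have "[:a:] dvd 1" by (intro poly_unitI) (auto simp: coeff_pCons split: nat.split)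
  then obtain g where g: "1 = [:a:] * g" by (elim dvdE)
  have "coeff ([:a:] * g) 0 = 1" unfolding g[symmetric] by simp
  moreover have "coeff ([:a:] * g) 0 = a * coeff g 0" by (simp only: coeff_mult_0 coeff_pCons_0)
  ultimately show "a dvd 1" by (metis dvd_triv_left)
qed


section \<open>The ring itself is not atomic\<close>

text \<open>If \<open>a\<close> and its factor \<open>b\<close> generate the same ideal, then \<open>b = d * a\<close> gives \<open>a * (1 - d * c) = 0\<close>,
  where \<open>1 - d * c\<close> is a unit.\<close>

lemma atom_product_of_max_ideal_eq_0:
  fixes a :: "'k::field trunc_ring"
  assumes "atom a" "a = b * c" "b \<in> max_ideal" "c \<in> max_ideal"
  shows "a = 0"
proof -
  have vanish: "a = 0" if "ideal_generated {a} = ideal_generated {x}" "a = x * y" "y \<in> max_ideal" for x y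
  proof -
    have "x \<in> ideal_generated {a}"
      unfolding that(1) unfolding ideal_generated_def by (rule module.span_base[OF module_times]) simp
    then obtain d where "x = d * a"
      unfolding ideal_generated_def module.span_singleton[OF module_times] by blast
    have "a * (1 - d * y) = (x - d * a) * y" using that(2) by (simp add: algebra_simps)
    then have "a * (1 - d * y) = 0" using \<open>x = d * a\<close> by simp
    have "1 - d * y dvd 1"
      using that(3) by (simp add: unit_iff_residue max_ideal_iff_residue)
    then obtain e where "1 = (1 - d * y) * e" by (elim dvdE)
    then have "a = a * (1 - d * y) * e" by (simp add: mult.assoc)
    then show ?thesis using \<open>a * (1 - d * y) = 0\<close> by simp
  qed
  from assms(1,2) have "ideal_generated {a} = ideal_generated {b} \<or> ideal_generated {a} = ideal_generated {c}"
    by (auto simp: atom_def)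
  moreover have "a = c * b" using assms(2) by (simp only: mult.commute)
  ultimately show ?thesis using vanish assms(2-4) by blast
qed

lemma CHAR_trunc_ring: "CHAR('k::field trunc_ring) = CHAR('k)"
proof -
  have of_nat: "(of_nat n :: 'k trunc_ring) = scaled_monomial 0 (of_nat n)" for n
    by (induction n) (simp_all add: zero_trunc_ring.abs_eq one_trunc_ring.abs_eq
        plus_trunc_ring.abs_eq single_add)
  have "residue (of_nat n :: 'k trunc_ring) = of_nat n" for n
    by (simp only: of_nat residue_scaled_monomial if_True simp_thms)
  then have "(of_nat n :: 'k) = 0" if "(of_nat n :: 'k trunc_ring) = 0" for n
    using that by (metis residue_zero)
  moreover have "(of_nat n :: 'k trunc_ring) = 0" if "(of_nat n :: 'k) = 0" for n
    by (simp only: of_nat that single_zero zero_trunc_ring.abs_eq)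
  ultimately have "(of_nat n :: 'k trunc_ring) = 0 \<longleftrightarrow> (of_nat n :: 'k) = 0" for n
    by blast
  then show ?thesis by (intro CHAR_eqI) (simp_all add: of_nat_eq_0_iff_char_dvd)
qed

lift_definition divide_nonneg_rat :: "nonneg_rat \<Rightarrow> nat \<Rightarrow> nonneg_rat" is "\<lambda>q n. q / of_nat n"
  by simp

lemma scaled_monomial_power_root:
  fixes m :: exponents
  assumes "n > 0"
  obtains m' where "\<And>c::'k::field. scaled_monomial m' c ^ n = scaled_monomial m (c ^ n)"
proof -
  let ?m = "Poly_Mapping.map (\<lambda>q. divide_nonneg_rat q n) m"
  have 0: "divide_nonneg_rat 0 n = 0" by transfer simp
  have mult: "rat_of_nonneg (Poly_Mapping.lookup ((\<Sum>j<k. ?m)) i)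
      = of_nat k * (rat_of_nonneg (Poly_Mapping.lookup m i) / of_nat n)" for i k
    by (induction k) (auto simp: lookup_add map.rep_eq when_def divide_nonneg_rat.rep_eq distrib_right add_divide_distrib
        simp del: sum_constant)
  have "(\<Sum>j<n. ?m) = m"
    by (rule poly_mapping_eqI) (use assms in \<open>simp add: mult flip: rat_of_nonneg_inject del: sum_constant\<close>)
  moreover have "scaled_monomial ?m c ^ k = scaled_monomial (\<Sum>j<k. ?m) (c ^ k)" for k and c :: 'k
    by (induction k) (simp_all add: one_trunc_ring.abs_eq scaled_monomial_mult add.commute del: sum_constant)
  ultimately show ?thesis using that by metis
qed

text \<open>Monomials have \<open>p\<close>-th roots because exponents are divisible and the field is perfect; sums of
  \<open>p\<close>-th powers are \<open>p\<close>-th powers because the characteristic is \<open>p\<close>.\<close>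

lemma max_ideal_power_root:
  fixes a :: "'k::field trunc_ring"
  assumes "prime CHAR('k)" "perfect_field TYPE('k)" "a \<in> max_ideal"
  shows "\<exists>b\<in>max_ideal. a = b ^ CHAR('k)"
proof -
  let ?p = "CHAR('k)"
  have p: "?p > 0" using assms(1) by (simp add: prime_gt_0_nat)
  have root: "\<exists>b. t = b ^ ?p" if t: "t = scaled_monomial m c" for t :: "'k trunc_ring" and m c
  proof -
    from assms(2) p obtain d where d: "d ^ ?p = c" by (auto simp: perfect_field_def)
    obtain m' where "\<And>c::'k. scaled_monomial m' c ^ ?p = scaled_monomial m (c ^ ?p)"
      using scaled_monomial_power_root[OF p] by blast
    then show ?thesis using t d by metis
  qed
  have "\<exists>b. (\<Sum>m\<in>S. scaled_monomial m (Poly_Mapping.lookup (canonical a) m)) = b ^ ?p" if "finite S" for S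
    using that
  proof (induction S rule: finite_induct)
    case empty
    show ?case using p by (intro exI[of _ 0]) (simp add: power_0_left)
  next
    case (insert m S)
    from insert obtain b where b: "(\<Sum>m\<in>S. scaled_monomial m (Poly_Mapping.lookup (canonical a) m)) = b ^ ?p"
      by blast
    obtain b' where b': "scaled_monomial m (Poly_Mapping.lookup (canonical a) m) = b' ^ ?p"
      using root by blast
    have "(b' + b) ^ ?p = b' ^ ?p + b ^ ?p"
      using freshmans_dream[where 'a = "'k trunc_ring"] assms(1) by (simp add: CHAR_trunc_ring)
    then show ?case using insert b b' by (intro exI[of _ "b' + b"]) simp
  qed
  from this[of "Poly_Mapping.keys (canonical a)"] obtain b where b: "a = b ^ ?p"
    by (auto simp: sum_scaled_monomials)
  have "residue (b ^ n) = residue b ^ n" for n by (induction n) simp_all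
  with b p assms(3) have "b \<in> max_ideal" by (auto simp: max_ideal_iff_residue)
  with b show ?thesis by blast
qed

lemma nonzero_not_atom:
  fixes a :: "'k::field trunc_ring"
  assumes "prime CHAR('k)" "perfect_field TYPE('k)" "a \<noteq> 0"
  shows "\<not> atom a"
proof
  assume a: "atom a"
  then have "a \<in> max_ideal" by (auto simp: atom_def unit_iff_residue max_ideal_iff_residue)
  from max_ideal_power_root[OF assms(1,2) this] obtain b where b: "b \<in> max_ideal" "a = b ^ CHAR('k)"
    by blast
  obtain k where k: "CHAR('k) = Suc (Suc k)"
    using prime_ge_2_nat[OF assms(1)] by (metis add_2_eq_Suc le_Suc_ex)
  have "a = b * b ^ Suc k" using b k by simp
  moreover have "b ^ Suc k \<in> max_ideal" using b(1) by (simp add: max_ideal_iff_residue)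
  ultimately show False using atom_product_of_max_ideal_eq_0[OF a] b(1) assms(3) by blast
qed

lemma not_atomic_trunc_ring:
  assumes "prime CHAR('k::field)" "perfect_field TYPE('k)"
  shows "\<not> atomic TYPE('k trunc_ring)"
proof
  assume atomic: "atomic TYPE('k trunc_ring)"
  define a :: "'k trunc_ring" where "a = scaled_monomial (unit_exponent 0) 1"
  have "a \<noteq> 0"
    by (simp add: a_def canonical_scaled_monomial flip: canonical_eq_0_iff)
  have "\<not> a dvd 1" by (simp add: a_def unit_iff_residue residue_scaled_monomial)
  then obtain as where as: "\<forall>b\<in>set as. atom b" "a = prod_list as"
    using atomic \<open>a \<noteq> 0\<close> by (auto simp: atomic_def)
  show False
  proof (cases as)
    case Nil
    then show ?thesis using as \<open>\<not> a dvd 1\<close> by simp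
  next
    case (Cons b bs)
    then have "b \<noteq> 0" using as \<open>a \<noteq> 0\<close> by auto
    then show ?thesis using as Cons nonzero_not_atom[OF assms] by auto
  qed
qed


section \<open>Homogeneous components of polynomials over the truncated ring\<close>

text \<open>The set \<open>V\<close> selects the monomials in the variables with index in \<open>V\<close>, so that a component
  combines the passage to degree \<open>r\<close> with setting all other variables to zero.\<close>

definition component :: "nat set \<Rightarrow> rat \<Rightarrow> 'k::field trunc_ring poly \<Rightarrow> 'k ratexp_poly poly" where
  "component V r f =
     map_poly (\<lambda>a. restrict_keys {m. Poly_Mapping.keys m \<subseteq> V \<and> total_degree m = r} (canonical a)) f"

definition order_ge :: "nat set \<Rightarrow> rat \<Rightarrow> 'k::field trunc_ring poly \<Rightarrow> bool" where
  "order_ge V r f \<longleftrightarrow> (\<forall>i. \<forall>m\<in>Poly_Mapping.keys (canonical (coeff f i)).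
      Poly_Mapping.keys m \<subseteq> V \<longrightarrow> r \<le> total_degree m)"

lemma coeff_component:
  "coeff (component V r f) i =
     restrict_keys {m. Poly_Mapping.keys m \<subseteq> V \<and> total_degree m = r} (canonical (coeff f i))"
  by (simp add: component_def coeff_map_poly)

lemma degree_component: "degree (component V r f) \<le> degree f"
  by (rule degree_le) (simp add: coeff_component coeff_eq_0)

lemma component_add: "component V r (f + g) = component V r f + component V r g"
  by (rule poly_eqI) (simp add: coeff_component canonical_add restrict_keys_add)

lemma component_zero [simp]: "component V r 0 = 0"
  by (simp add: component_def)

lemma component_pCons:
  "component V r (pCons a f) =
     pCons (restrict_keys {m. Poly_Mapping.keys m \<subseteq> V \<and> total_degree m = r} (canonical a)) (component V r f)"
  by (simp add: component_def map_poly_pCons)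

lemma order_ge_0 [simp]: "order_ge V 0 f"
  by (simp add: order_ge_def)

lemma component_below_order:
  assumes "order_ge V r f" "s < r"
  shows "component V s f = 0"
proof (rule poly_eqI)
  fix i
  have "Poly_Mapping.keys (coeff (component V s f) i) = {}"
    using assms by (force simp: coeff_component keys_restrict_keys order_ge_def)
  then show "coeff (component V s f) i = coeff 0 i" by simp
qed

text \<open>Monomials in \<open>V\<close> are products of monomials in \<open>V\<close> only, and a monomial of the least possible degree
  \<open>r + s\<close> arises only from monomials of degrees \<open>r\<close> and \<open>s\<close>.  The bound \<open>r + s \<le> 1\<close> keeps the product
  clear of the truncation.\<close>

lemma component_mult:
  assumes "order_ge V r f" "order_ge V s g" "r + s \<le> 1"
  shows "component V (r + s) (f * g) = component V r f * component V s g"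
proof (rule poly_eqI)
  fix n
  let ?K = "\<lambda>r. {m. Poly_Mapping.keys m \<subseteq> V \<and> total_degree m = r}"
  have mult: "restrict_keys (?K (r + s)) (canonical (coeff f i * coeff g j)) =
      restrict_keys (?K r) (canonical (coeff f i)) * restrict_keys (?K s) (canonical (coeff g j))" for i j
  proof -
    have "?K (r + s) \<inter> {m. total_degree m \<le> 1} = ?K (r + s)" using assms(3) by auto
    then have "restrict_keys (?K (r + s)) (canonical (coeff f i * coeff g j)) =
        restrict_keys (?K (r + s)) (canonical (coeff f i) * canonical (coeff g j))"
      by (simp add: canonical_mult restrict_keys_restrict_keys)
    also have "\<dots> = restrict_keys (?K r) (canonical (coeff f i)) * restrict_keys (?K s) (canonical (coeff g j))"
    proof (rule restrict_keys_mult)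
      fix k l
      assume "k \<in> Poly_Mapping.keys (canonical (coeff f i))" "l \<in> Poly_Mapping.keys (canonical (coeff g j))"
      then have "Poly_Mapping.keys k \<subseteq> V \<Longrightarrow> r \<le> total_degree k" "Poly_Mapping.keys l \<subseteq> V \<Longrightarrow> s \<le> total_degree l"
        using assms(1,2) by (auto simp: order_ge_def)
      then show "k + l \<in> ?K (r + s) \<longleftrightarrow> k \<in> ?K r \<and> l \<in> ?K s"
        by (auto simp: keys_exponents_add)
    qed
    finally show ?thesis .
  qed
  show "coeff (component V (r + s) (f * g)) n = coeff (component V r f * component V s g) n"
    by (simp add: coeff_component coeff_mult canonical_sum restrict_keys_sum mult)
qed

lemma lowest_component_exists:
  assumes "m \<in> Poly_Mapping.keys (canonical (coeff f i))" "Poly_Mapping.keys m \<subseteq> V"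
  obtains r where "0 \<le> r" "r \<le> 1" "order_ge V r f" "component V r f \<noteq> 0"
proof -
  define D where "D = total_degree ` {m \<in> (\<Union>i\<le>degree f. Poly_Mapping.keys (canonical (coeff f i))). Poly_Mapping.keys m \<subseteq> V}"
  have D: "total_degree m \<in> D"
    if m: "m \<in> Poly_Mapping.keys (canonical (coeff f i))" "Poly_Mapping.keys m \<subseteq> V" for m i
  proof -
    have "coeff f i \<noteq> 0" using m(1) by auto
    then have "i \<le> degree f" by (rule le_degree)
    then show ?thesis using m by (auto simp: D_def)
  qed
  have "finite D" by (simp add: D_def)
  moreover have "D \<noteq> {}" using D assms by blast
  ultimately have "Min D \<in> D" by (rule Min_in)
  then obtain n j where n: "n \<in> Poly_Mapping.keys (canonical (coeff f j))" "Poly_Mapping.keys n \<subseteq> V"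
      "total_degree n = Min D"
    unfolding D_def by auto
  show ?thesis
  proof
    show "0 \<le> Min D" using n(3) total_degree_nonneg by metis
    show "Min D \<le> 1" using n(1,3) keys_canonical by metis
    show "order_ge V (Min D) f" using D \<open>finite D\<close> by (auto simp: order_ge_def)
    have "n \<in> Poly_Mapping.keys (coeff (component V (Min D) f) j)"
      using n by (simp add: coeff_component keys_restrict_keys)
    then show "component V (Min D) f \<noteq> 0" by auto
  qed
qed


section \<open>Reduction modulo the maximal ideal\<close>

abbreviation reduction :: "'k::field trunc_ring poly \<Rightarrow> 'k ratexp_poly poly" where
  "reduction \<equiv> component UNIV 0"

lemma reduction_mult: "reduction (f * g) = reduction f * reduction g"
  using component_mult[of UNIV 0 f 0 g] by simp

lemma coeff_reduction_eq_0_iff: "coeff (reduction f) i = 0 \<longleftrightarrow> residue (coeff f i) = 0"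
proof -
  have "coeff (reduction f) i = Poly_Mapping.single 0 (residue (coeff f i))"
    by (rule poly_mapping_eqI) (simp add: coeff_component lookup_restrict_keys residue_def lookup_single when_def)
  then show ?thesis by simp
qed

lemma reduction_eq_0_iff: "reduction f = 0 \<longleftrightarrow> f \<in> max_ideal_poly"
  by (simp add: poly_eq_iff coeff_reduction_eq_0_iff max_ideal_poly_iff_residue)

lemma reduction_one [simp]: "reduction 1 = 1"
proof (rule poly_eqI)
  fix i
  have "coeff (1 :: 'a trunc_ring poly) i = (if i = 0 then 1 else 0)" by simp
  moreover have "restrict_keys {m. Poly_Mapping.keys m \<subseteq> UNIV \<and> total_degree m = 0} (1 :: 'a ratexp_poly) = 1"
    by (rule restrict_keys_eq_self) simp
  ultimately show "coeff (reduction 1) i = coeff (1 :: 'a ratexp_poly poly) i"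
    by (simp add: coeff_component)
qed

lemma has_unit_coeff_iff: "has_unit_coeff f \<longleftrightarrow> reduction f \<noteq> 0"
  by (simp add: has_unit_coeff_def reduction_eq_0_iff max_ideal_poly_iff_residue unit_iff_residue)

lemma poly_unit_iff: "f dvd 1 \<longleftrightarrow> reduction f \<noteq> 0 \<and> degree (reduction f) = 0"
proof
  assume "f dvd 1"
  then obtain g where "1 = f * g" by (elim dvdE)
  then have *: "reduction f * reduction g = 1" by (metis reduction_mult reduction_one)
  then have nz: "reduction f \<noteq> 0" "reduction g \<noteq> 0" by auto
  have "degree (reduction f) + degree (reduction g) = 0"
    unfolding degree_mult_eq[OF nz, symmetric] * by simp
  with nz show "reduction f \<noteq> 0 \<and> degree (reduction f) = 0" by simp
next
  assume f: "reduction f \<noteq> 0 \<and> degree (reduction f) = 0"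
  then have "coeff (reduction f) 0 \<noteq> 0" by (metis leading_coeff_0_iff)
  moreover have "coeff (reduction f) i = 0" if "i > 0" for i using f that by (simp add: coeff_eq_0)
  ultimately show "f dvd 1" by (intro poly_unitI) (auto simp: coeff_reduction_eq_0_iff)
qed

lemma Max_unit_coeffs:
  assumes "reduction f \<noteq> 0"
  shows "Max {n. coeff f n dvd 1} = degree (reduction f)"
proof (rule Max_eqI[OF finite_unit_coeffs])
  show "degree (reduction f) \<in> {n. coeff f n dvd 1}"
    using assms coeff_reduction_eq_0_iff[of f "degree (reduction f)"] by (simp add: unit_iff_residue)
  fix n assume "n \<in> {n. coeff f n dvd 1}"
  then have "coeff (reduction f) n \<noteq> 0" by (simp add: coeff_reduction_eq_0_iff unit_iff_residue)
  then show "n \<le> degree (reduction f)" by (rule le_degree)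
qed

text \<open>The degree of the reduction is additive, and it is positive on nonunits.\<close>

lemma strong_atom_factorization_of_nonzero_reduction:
  assumes "reduction f \<noteq> 0" "\<not> f dvd 1"
  shows "\<exists>as. (\<forall>a\<in>set as. strong_atom a) \<and> f = prod_list as \<and> length as \<le> degree (reduction f)"
  using assms
proof (induction "degree (reduction f)" arbitrary: f rule: less_induct)
  case less
  show ?case
  proof (cases "strong_atom f")
    case True
    then show ?thesis using less.prems by (intro exI[of _ "[f]"]) (simp add: poly_unit_iff)
  next
    case False
    then obtain g h where gh: "f = g * h" "\<not> g dvd 1" "\<not> h dvd 1"
      using less.prems by (auto simp: strong_atom_def)
    have red: "reduction f = reduction g * reduction h" by (simp add: gh reduction_mult)
    then have nz: "reduction g \<noteq> 0" "reduction h \<noteq> 0" using less.prems by auto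
    have deg: "degree (reduction f) = degree (reduction g) + degree (reduction h)"
      by (simp add: red degree_mult_eq nz)
    have pos: "degree (reduction g) > 0" "degree (reduction h) > 0"
      using gh nz by (auto simp: poly_unit_iff)
    obtain as where as: "\<forall>a\<in>set as. strong_atom a" "g = prod_list as" "length as \<le> degree (reduction g)"
      using less.hyps[of g] deg pos nz gh by auto
    obtain bs where bs: "\<forall>a\<in>set bs. strong_atom a" "h = prod_list bs" "length bs \<le> degree (reduction h)"
      using less.hyps[of h] deg pos nz gh by auto
    show ?thesis using as bs gh(1) deg by (intro exI[of _ "as @ bs"]) auto
  qed
qed


section \<open>Polynomials that are not a product of two polynomials over the maximal ideal\<close>

text \<open>If \<open>r\<close> is the lowest degree that occurs in \<open>g\<close>, the component of \<open>f\<close> in degree \<open>r\<close> is the product of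
  that of \<open>g\<close> with the reduction of \<open>h\<close>, in a domain.\<close>

lemma degree_reduction_factor_le:
  assumes "f = g * h" "f \<noteq> 0" "reduction h \<noteq> 0"
  shows "degree (reduction h) \<le> degree f"
proof -
  have "g \<noteq> 0" using assms by auto
  then have "canonical (coeff g (degree g)) \<noteq> 0" by simp
  then obtain m where "m \<in> Poly_Mapping.keys (canonical (coeff g (degree g)))"
    by (meson all_not_in_conv keys_eq_empty)
  then obtain r where r: "r \<le> 1" "order_ge UNIV r g" "component UNIV r g \<noteq> 0"
    by (rule lowest_component_exists[where V = UNIV]) auto
  have "component UNIV (r + 0) f = component UNIV r g * reduction h"
    unfolding assms(1) by (rule component_mult) (use r in auto)
  then have "degree (reduction h) \<le> degree (component UNIV r f)"
    using r(3) assms(3) by (simp add: degree_mult_eq)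
  also have "\<dots> \<le> degree f" by (rule degree_component)
  finally show ?thesis .
qed

text \<open>Collect as much as possible into a factor \<open>h\<close> with nonzero reduction.  The cofactor is then a strong
  atom: any further factor with nonzero reduction could be moved over to \<open>h\<close>.\<close>

lemma strong_atom_factorization_outside_square:
  assumes "f \<in> max_ideal_poly" "\<not> factors_in_max_ideal_poly f" "f \<noteq> 0"
  shows "\<exists>as. (\<forall>a\<in>set as. strong_atom a) \<and> f = prod_list as \<and> length as \<le> degree f + 1"
proof -
  define P where "P d \<longleftrightarrow> (\<exists>g h. f = g * h \<and> reduction h \<noteq> 0 \<and> degree (reduction h) = d)" for d
  have bounded: "d \<le> degree f" if "P d" for d
    using that degree_reduction_factor_le assms(3) unfolding P_def by metis
  have "f = f * 1 \<and> reduction (1 :: 'a trunc_ring poly) \<noteq> 0" by simp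
  then have "P (degree (reduction (1 :: 'a trunc_ring poly)))" unfolding P_def by blast
  then obtain d where d: "P d" and max: "\<And>d'. P d' \<Longrightarrow> d' \<le> d"
    using Nat.ex_has_greatest_nat[of P _ "degree f"] bounded by metis
  have atom: "strong_atom g" if gh: "f = g * h" "reduction h \<noteq> 0" "degree (reduction h) = d" for g h
  proof -
    have "reduction g * reduction h = 0"
      using assms(1) by (simp add: gh(1) reduction_eq_0_iff flip: reduction_mult)
    then have "reduction g = 0" using gh(2) by simp
    have unit: "v dvd 1" if "g = u * v" "reduction v \<noteq> 0" for u v
    proof -
      have "f = u * (v * h)" by (simp add: gh(1) that(1) mult.assoc)
      moreover have "reduction (v * h) \<noteq> 0" using that gh(2) by (simp add: reduction_mult)
      ultimately have "degree (reduction (v * h)) \<le> d" using max P_def by blast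
      then have "degree (reduction v) = 0"
        using that(2) gh(2,3) by (simp add: reduction_mult degree_mult_eq)
      then show ?thesis using that(2) by (simp add: poly_unit_iff)
    qed
    show ?thesis
      unfolding strong_atom_def
    proof (intro conjI allI impI)
      show "\<not> g dvd 1" using \<open>reduction g = 0\<close> by (simp add: poly_unit_iff)
      fix u v assume uv: "g = u * v"
      show "u dvd 1 \<or> v dvd 1"
      proof (cases "reduction u = 0 \<and> reduction v = 0")
        case True
        then have "u \<in> max_ideal_poly" "v * h \<in> max_ideal_poly"
          by (simp_all add: reduction_mult flip: reduction_eq_0_iff)
        moreover have "f = u * (v * h)" by (simp add: gh(1) uv mult.assoc)
        ultimately show ?thesis using assms(2) unfolding factors_in_max_ideal_poly_def by blast
      next
        case False
        then show ?thesis using unit[of u v] unit[of v u] uv by (auto simp: mult.commute)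
      qed
    qed
  qed
  from d obtain g h where gh: "f = g * h" "reduction h \<noteq> 0" "degree (reduction h) = d"
    unfolding P_def by blast
  show ?thesis
  proof (cases "h dvd 1")
    case True
    \<comment> \<open>Then the maximum is \<open>d = 0\<close>, which the trivial factorization \<open>f * 1\<close> attains as well.\<close>
    then have "strong_atom f" using atom[of f 1] gh(3) by (simp add: poly_unit_iff)
    then show ?thesis by (intro exI[of _ "[f]"]) simp
  next
    case False
    then obtain as where as: "\<forall>a\<in>set as. strong_atom a" "h = prod_list as" "length as \<le> d"
      using strong_atom_factorization_of_nonzero_reduction[OF gh(2)] gh(3) by auto
    then show ?thesis using bounded[OF d] atom[OF gh] gh(1) by (intro exI[of _ "g # as"]) auto
  qed
qed


section \<open>Strong atoms from two fresh variables\<close>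

text \<open>The polynomial \<open>x_N + x_(N+1) t\<close>.  It is linear with coefficients that have no common factor, and
  these coefficients have the largest possible degree, so they annihilate the maximal ideal.\<close>

definition fresh_linear :: "nat \<Rightarrow> 'k::field trunc_ring poly" where
  "fresh_linear N = [:scaled_monomial (unit_exponent N) 1, scaled_monomial (unit_exponent (Suc N)) 1:]"

lemma fresh_linear_in_max_ideal_poly: "fresh_linear N \<in> max_ideal_poly"
  by (auto simp: fresh_linear_def max_ideal_poly_iff_residue coeff_pCons residue_scaled_monomial split: nat.split)

lemma degree_one_mult_max_ideal:
  assumes "total_degree m = 1" "a \<in> max_ideal"
  shows "scaled_monomial m c * a = 0"
proof -
  have "scaled_monomial m c * scaled_monomial n (Poly_Mapping.lookup (canonical a) n) = 0"
    if "n \<in> Poly_Mapping.keys (canonical a)" for n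
  proof -
    have "n \<noteq> 0" using that assms(2) by (auto simp: max_ideal_iff_residue residue_def in_keys_iff)
    then have "total_degree n > 0" by (rule total_degree_pos)
    then show ?thesis
      unfolding scaled_monomial_mult by (intro scaled_monomial_eq_0) (simp add: assms(1))
  qed
  then have "scaled_monomial m c *
      (\<Sum>n\<in>Poly_Mapping.keys (canonical a). scaled_monomial n (Poly_Mapping.lookup (canonical a) n)) = 0"
    by (simp add: sum_distrib_left)
  then show ?thesis by (simp only: sum_scaled_monomials)
qed

lemma fresh_linear_mult:
  assumes "f \<in> max_ideal_poly"
  shows "fresh_linear N * f = 0"
proof -
  have "smult (scaled_monomial (unit_exponent i) 1) f = 0" for i
    using assms by (intro poly_eqI) (simp add: max_ideal_poly_def degree_one_mult_max_ideal)
  then show ?thesis by (simp add: fresh_linear_def)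
qed

lemma component_fresh_linear:
  "component {N, Suc N} r (fresh_linear N) =
     (if r = 1 then [:Poly_Mapping.single (unit_exponent N) 1, Poly_Mapping.single (unit_exponent (Suc N)) (1::'k::field):]
      else 0)"
proof -
  let ?K = "{m. Poly_Mapping.keys m \<subseteq> {N, Suc N} \<and> total_degree m = r}"
  have "restrict_keys ?K (canonical (scaled_monomial (unit_exponent i) 1)) =
      (if r = 1 then Poly_Mapping.single (unit_exponent i) (1::'k) else 0)" if "i \<in> {N, Suc N}" for i
    using that by (simp add: canonical_scaled_monomial restrict_keys_single)
  then have "restrict_keys ?K (canonical (scaled_monomial (unit_exponent N) 1)) =
        (if r = 1 then Poly_Mapping.single (unit_exponent N) (1::'k) else 0)"
      "restrict_keys ?K (canonical (scaled_monomial (unit_exponent (Suc N)) 1)) =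
        (if r = 1 then Poly_Mapping.single (unit_exponent (Suc N)) (1::'k) else 0)"
    by blast+
  then show ?thesis
    unfolding fresh_linear_def component_pCons by (simp only: component_zero pCons_0_0 split: if_split) simp
qed

lemma exists_fresh_index:
  "\<exists>N. \<forall>i. \<forall>m\<in>Poly_Mapping.keys (canonical (coeff f i)). \<forall>n\<ge>N. n \<notin> Poly_Mapping.keys m"
proof -
  define S where "S = (\<Union>i\<le>degree f. \<Union>m\<in>Poly_Mapping.keys (canonical (coeff f i)). Poly_Mapping.keys m)"
  have "finite S" unfolding S_def by (intro finite_UN_I finite_atMost finite_keys)
  then obtain N where N: "\<forall>n\<in>S. n < N" unfolding finite_nat_set_iff_bounded ..
  have "n \<notin> Poly_Mapping.keys m" if m: "m \<in> Poly_Mapping.keys (canonical (coeff f i))" and n: "n \<ge> N" for i m n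
  proof
    assume "n \<in> Poly_Mapping.keys m"
    moreover have "coeff f i \<noteq> 0" using m by auto
    then have "i \<le> degree f" by (rule le_degree)
    ultimately have "n \<in> S" using m unfolding S_def by blast
    then show False using N n by auto
  qed
  then show ?thesis by blast
qed

lemma component_avoiding:
  assumes "f \<in> max_ideal_poly"
    and "\<And>i m. m \<in> Poly_Mapping.keys (canonical (coeff f i)) \<Longrightarrow> Poly_Mapping.keys m \<inter> V = {}"
  shows "component V r f = 0"
proof (rule poly_eqI)
  fix i
  have "\<not> Poly_Mapping.keys m \<subseteq> V" if "m \<in> Poly_Mapping.keys (canonical (coeff f i))" for m
  proof
    assume "Poly_Mapping.keys m \<subseteq> V"
    then have "m = 0" using assms(2)[OF that] by (simp add: inf_absorb1)
    then show False using assms(1) that by (simp add: max_ideal_poly_iff_residue residue_def in_keys_iff)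
  qed
  then have "Poly_Mapping.keys (coeff (component V r f) i) = {}"
    by (auto simp: coeff_component keys_restrict_keys)
  then show "coeff (component V r f) i = coeff 0 i" by simp
qed

lemma component_degree_0: "component V 0 f = reduction f"
  by (rule poly_eqI) (auto simp: coeff_component intro!: arg_cong2[where f = restrict_keys])

text \<open>If no monomial of \<open>b\<close> lay in \<open>V\<close>, neither would one of \<open>b * c\<close>.\<close>

lemma lowest_component_of_factor:
  assumes "component V d (b * c) \<noteq> 0" "d \<le> 1"
  obtains r where "0 \<le> r" "r \<le> 1" "order_ge V r b" "component V r b \<noteq> 0"
proof (cases "\<exists>i. \<exists>m\<in>Poly_Mapping.keys (canonical (coeff b i)). Poly_Mapping.keys m \<subseteq> V")
  case True
  then show ?thesis using lowest_component_exists that by metis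
next
  case False
  \<comment> \<open>Any lower bound holds vacuously; one above \<open>d\<close> shows that the component in degree \<open>d\<close> vanishes.\<close>
  then have "order_ge V d b" "order_ge V (d + 1) b" by (auto simp: order_ge_def)
  then have "component V d b = 0" by (intro component_below_order[of V "d + 1"]) auto
  moreover have "component V (d + 0) (b * c) = component V d b * component V 0 c"
    using \<open>order_ge V d b\<close> assms(2) by (intro component_mult) auto
  ultimately show ?thesis using assms(1) by simp
qed

text \<open>Let \<open>r\<close> and \<open>s\<close> be the lowest degrees of the two factors.  A sum above \<open>d\<close> would make the component
  of the product in degree \<open>d\<close> vanish; a sum below \<open>d\<close> would produce a nonzero component in a degree
  other than \<open>d\<close>.\<close>

lemma lowest_components_of_homogeneous_product:
  assumes "component V d (b * c) \<noteq> 0" "d \<le> 1" "\<And>r. r \<noteq> d \<Longrightarrow> component V r (b * c) = 0"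
  obtains r s where "component V r b * component V s c = component V d (b * c)"
proof -
  obtain r where r: "0 \<le> r" "r \<le> 1" "order_ge V r b" "component V r b \<noteq> 0"
    using lowest_component_of_factor[OF assms(1,2)] .
  obtain s where s: "0 \<le> s" "s \<le> 1" "order_ge V s c" "component V s c \<noteq> 0"
    using lowest_component_of_factor[of V d c b] assms(1,2) by (auto simp: mult.commute)
  have "r + s \<le> d"
  proof (rule ccontr)
    assume "\<not> r + s \<le> d"
    then have less: "d - s < r" by simp
    then have "component V (d - s) b = 0" using r(3) by (rule component_below_order[rotated])
    moreover have "order_ge V (d - s) b" using r(3) less by (force simp: order_ge_def)
    then have "component V ((d - s) + s) (b * c) = component V (d - s) b * component V s c"
      using s(3) assms(2) by (intro component_mult) auto
    ultimately show False using assms(1) by simp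
  qed
  then have prod: "component V (r + s) (b * c) = component V r b * component V s c"
    using r(3) s(3) assms(2) by (intro component_mult) auto
  then have "component V (r + s) (b * c) \<noteq> 0" using r(4) s(4) by simp
  then have "r + s = d" using assms(3) by blast
  then show ?thesis using that[of r s] prod by simp
qed

text \<open>The highest exponent of a variable is additive on products, as the parts in which it is attained
  have a nonzero product.  So a variable that does not occur in a monomial does not occur in its
  divisors.\<close>

lemma keys_of_monomial_divisor:
  fixes a b :: "'k::field ratexp_poly"
  assumes "a * b = Poly_Mapping.single k c" "c \<noteq> 0" "z \<notin> Poly_Mapping.keys k" "m \<in> Poly_Mapping.keys a"
  shows "z \<notin> Poly_Mapping.keys m"
proof -
  define w where "w n = rat_of_nonneg (Poly_Mapping.lookup n z)" for n :: exponents
  have w_add: "w (n + n') = w n + w n'" for n n' by (simp add: w_def lookup_add)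
  have "a * b \<noteq> 0" using assms(1,2) by simp
  then have "Poly_Mapping.keys a \<noteq> {}" "Poly_Mapping.keys b \<noteq> {}" by auto
  define A where "A = Max (w ` Poly_Mapping.keys a)"
  define B where "B = Max (w ` Poly_Mapping.keys b)"
  have top: "restrict_keys {n. w n = Max (w ` Poly_Mapping.keys f)} f \<noteq> 0"
    if nonempty: "Poly_Mapping.keys f \<noteq> {}" for f :: "'k ratexp_poly"
  proof -
    have "Max (w ` Poly_Mapping.keys f) \<in> w ` Poly_Mapping.keys f" using nonempty by (intro Max_in) auto
    then have "Poly_Mapping.keys (restrict_keys {n. w n = Max (w ` Poly_Mapping.keys f)} f) \<noteq> {}"
      by (force simp: keys_restrict_keys)
    then show ?thesis by auto
  qed
  have "restrict_keys {n. w n = A + B} (a * b) = restrict_keys {n. w n = A} a * restrict_keys {n. w n = B} b"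
  proof (rule restrict_keys_mult)
    fix i j assume "i \<in> Poly_Mapping.keys a" "j \<in> Poly_Mapping.keys b"
    then have "w i \<le> A" "w j \<le> B" by (auto simp: A_def B_def)
    then show "i + j \<in> {n. w n = A + B} \<longleftrightarrow> i \<in> {n. w n = A} \<and> j \<in> {n. w n = B}"
      by (auto simp: w_add)
  qed
  moreover have "restrict_keys {n. w n = A} a \<noteq> 0" "restrict_keys {n. w n = B} b \<noteq> 0"
    unfolding A_def B_def using top \<open>Poly_Mapping.keys a \<noteq> {}\<close> \<open>Poly_Mapping.keys b \<noteq> {}\<close> by blast+
  ultimately have "restrict_keys {n. w n = A + B} (Poly_Mapping.single k c) \<noteq> 0"
    by (simp add: assms(1))
  then have "w k = A + B" by (auto simp: restrict_keys_single split: if_splits)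
  moreover have "w k = 0" using assms(3) by (simp add: w_def in_keys_iff)
  moreover have "0 \<le> B"
  proof -
    obtain n where "n \<in> Poly_Mapping.keys b" using \<open>Poly_Mapping.keys b \<noteq> {}\<close> by blast
    then have "w n \<le> B" by (auto simp: B_def)
    moreover have "0 \<le> w n" by (simp add: w_def)
    ultimately show ?thesis by linarith
  qed
  moreover have "w m \<le> A" using assms(4) by (auto simp: A_def)
  moreover have "0 \<le> w m" by (simp add: w_def)
  ultimately have "w m = 0" by linarith
  then show ?thesis by (simp add: w_def in_keys_iff)
qed

text \<open>On the components in the two fresh variables, \<open>g\<close> leaves no trace, so a factorization of
  \<open>g + fresh_linear N\<close> gives a factorization of \<open>x_N + x_(N+1) t\<close> in a polynomial ring over a domain.\<close>

lemma strong_atom_add_fresh_linear: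
  fixes g :: "'k::field trunc_ring poly"
  assumes g: "g \<in> max_ideal_poly"
    and fresh: "\<And>i m n. m \<in> Poly_Mapping.keys (canonical (coeff g i)) \<Longrightarrow> n \<ge> N \<Longrightarrow> n \<notin> Poly_Mapping.keys m"
  shows "strong_atom (g + fresh_linear N)"
proof -
  let ?V = "{N, Suc N}"
  let ?y = "Poly_Mapping.single (unit_exponent N) (1::'k)"
  let ?z = "Poly_Mapping.single (unit_exponent (Suc N)) (1::'k)"
  have "component ?V r g = 0" for r
    using fresh by (intro component_avoiding g) fastforce
  then have comp: "component ?V r (g + fresh_linear N) = (if r = 1 then [:?y, ?z:] else 0)" for r
    by (simp add: component_add component_fresh_linear del: pCons_eq_0_iff)
  have "?z \<noteq> 0" by simp
  \<comment> \<open>A lowest component that is a constant polynomial in \<open>t\<close> divides both variables; by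
    homogeneity it then has degree 0, so it is the reduction of its factor.\<close>
  have unit: "b dvd 1" if bc: "component ?V r b * component ?V s c = [:?y, ?z:]"
    and deg: "degree (component ?V r b) = 0" for b c :: "'k trunc_ring poly" and r s
  proof -
    from deg obtain a where a: "component ?V r b = [:a:]" by (metis degree_eq_zeroE)
    have "coeff (component ?V r b * component ?V s c) i = coeff [:?y, ?z:] i" for i by (simp add: bc)
    from this[of 0] this[of 1] have div: "a * coeff (component ?V s c) 0 = ?y" "a * coeff (component ?V s c) 1 = ?z"
      by (simp_all add: a)
    then have "a \<noteq> 0" using \<open>?z \<noteq> 0\<close> by auto
    then obtain m where m: "m \<in> Poly_Mapping.keys a" by (meson all_not_in_conv keys_eq_empty)
    have "Poly_Mapping.keys m = {}"
    proof -
      have "n \<notin> Poly_Mapping.keys m" for n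
      proof (cases "n = N")
        case True
        then show ?thesis using keys_of_monomial_divisor[OF div(2) _ _ m, of n] by simp
      next
        case False
        then show ?thesis using keys_of_monomial_divisor[OF div(1) _ _ m, of n] by simp
      qed
      then show ?thesis by blast
    qed
    then have "m = 0" by simp
    have "a = coeff (component ?V r b) 0" by (simp add: a)
    then have "total_degree m = r" using m by (simp add: coeff_component keys_restrict_keys)
    then have "r = 0" using \<open>m = 0\<close> by simp
    then have "reduction b = [:a:]" using a component_degree_0[of ?V b] by simp
    then show ?thesis using \<open>a \<noteq> 0\<close> by (simp add: poly_unit_iff)
  qed
  show ?thesis
    unfolding strong_atom_def
  proof (intro conjI allI impI)
    have "reduction (g + fresh_linear N) = 0"
      using g fresh_linear_in_max_ideal_poly by (simp add: component_add flip: reduction_eq_0_iff)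
    then show "\<not> g + fresh_linear N dvd 1" by (simp add: poly_unit_iff)
  next
    fix b c assume bc: "g + fresh_linear N = b * c"
    obtain r s where rs: "component ?V r b * component ?V s c = component ?V 1 (b * c)"
      using lowest_components_of_homogeneous_product[of ?V 1 b c] comp \<open>?z \<noteq> 0\<close> by (auto simp: bc)
    then have prod: "component ?V r b * component ?V s c = [:?y, ?z:]" using comp[of 1] by (simp add: bc)
    then have "component ?V r b \<noteq> 0" "component ?V s c \<noteq> 0" using \<open>?z \<noteq> 0\<close> by auto
    then have "degree (component ?V r b) + degree (component ?V s c) = degree [:?y, ?z:]"
      unfolding prod[symmetric] by (rule degree_mult_eq[symmetric])
    also have "\<dots> = 1" using \<open>?z \<noteq> 0\<close> by simp
    finally have "degree (component ?V r b) = 0 \<or> degree (component ?V s c) = 0" by linarith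
    moreover have "component ?V s c * component ?V r b = [:?y, ?z:]" using prod by (simp only: mult.commute)
    ultimately show "b dvd 1 \<or> c dvd 1" using unit prod by blast
  qed
qed

text \<open>The summand \<open>u\<close> has degree 1 in the variables, so its products with \<open>g\<close>, \<open>h\<close> and itself vanish.\<close>

lemma product_of_two_strong_atoms:
  fixes g h :: "'k::field trunc_ring poly"
  assumes "g \<in> max_ideal_poly" "h \<in> max_ideal_poly"
  shows "\<exists>a b. strong_atom a \<and> strong_atom b \<and> g * h = a * b"
proof -
  obtain M where M: "\<forall>i. \<forall>m\<in>Poly_Mapping.keys (canonical (coeff g i)). \<forall>n\<ge>M. n \<notin> Poly_Mapping.keys m"
    using exists_fresh_index by blast
  obtain M' where M': "\<forall>i. \<forall>m\<in>Poly_Mapping.keys (canonical (coeff h i)). \<forall>n\<ge>M'. n \<notin> Poly_Mapping.keys m"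
    using exists_fresh_index by blast
  define u :: "'k trunc_ring poly" where "u = fresh_linear (max M M')"
  have "strong_atom (g + u)" "strong_atom (h + u)"
    unfolding u_def using M M' assms by (auto intro!: strong_atom_add_fresh_linear)
  moreover have "(g + u) * (h + u) = g * h + u * g + u * h + u * u" by (simp add: algebra_simps)
  then have "(g + u) * (h + u) = g * h"
    using assms by (simp add: u_def fresh_linear_mult fresh_linear_in_max_ideal_poly)
  ultimately show ?thesis by metis
qed


section \<open>Factorization in the polynomial ring\<close>

theorem theorem2p6:
  fixes p :: nat
  assumes "prime p" and "CHAR('k::field) = p" and "perfect_field TYPE('k)"
  shows "\<not> atomic TYPE('k trunc_ring)
    \<and> strongly_atomic TYPE('k trunc_ring poly)
    \<and> (\<forall>f :: 'k trunc_ring poly. f \<noteq> 0 \<and> \<not> f dvd 1 \<longrightarrow>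
        (let case1 = has_unit_coeff f;
             case2 = (f \<in> max_ideal_poly \<and> factors_in_max_ideal_poly f);
             case3 = (f \<in> max_ideal_poly \<and> \<not> factors_in_max_ideal_poly f)
         in (case1 \<or> case2 \<or> case3)
          \<and> \<not> (case1 \<and> case2) \<and> \<not> (case1 \<and> case3) \<and> \<not> (case2 \<and> case3)
          \<and> (case1 \<longrightarrow>
               (\<exists>as. (\<forall>a\<in>set as. strong_atom a) \<and> f = prod_list as
                  \<and> length as \<le> Max {n. coeff f n dvd 1}))
          \<and> (case2 \<longrightarrow>
               (\<exists>a b. strong_atom a \<and> strong_atom b \<and> f = a * b))
          \<and> (case3 \<longrightarrow>
               (\<exists>as. (\<forall>a\<in>set as. strong_atom a) \<and> f = prod_list as
                  \<and> length as \<le> degree f + 2))))"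
proof -
  have case1: "\<exists>as. (\<forall>a\<in>set as. strong_atom a) \<and> f = prod_list as \<and> length as \<le> Max {n. coeff f n dvd 1}"
    if "has_unit_coeff f" "\<not> f dvd 1" for f :: "'k trunc_ring poly"
    using that strong_atom_factorization_of_nonzero_reduction[of f] Max_unit_coeffs[of f]
    by (simp add: has_unit_coeff_iff)
  have case2: "\<exists>a b. strong_atom a \<and> strong_atom b \<and> f = a * b"
    if "factors_in_max_ideal_poly f" for f :: "'k trunc_ring poly"
    using that product_of_two_strong_atoms unfolding factors_in_max_ideal_poly_def by blast
  have case3: "\<exists>as. (\<forall>a\<in>set as. strong_atom a) \<and> f = prod_list as \<and> length as \<le> degree f + 2"
    if f: "f \<in> max_ideal_poly" "\<not> factors_in_max_ideal_poly f" "f \<noteq> 0" for f :: "'k trunc_ring poly"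
    using strong_atom_factorization_outside_square[OF f] by (auto intro: le_SucI)
  have trichotomy: "has_unit_coeff f \<longleftrightarrow> f \<notin> max_ideal_poly" for f :: "'k trunc_ring poly"
    by (simp add: has_unit_coeff_iff reduction_eq_0_iff)
  have strongly_atomic: "strongly_atomic TYPE('k trunc_ring poly)"
    unfolding strongly_atomic_def
  proof (intro allI impI)
    fix f :: "'k trunc_ring poly"
    assume f: "f \<noteq> 0 \<and> \<not> f dvd 1"
    consider "has_unit_coeff f" | "factors_in_max_ideal_poly f" |
        "f \<in> max_ideal_poly" "\<not> factors_in_max_ideal_poly f"
      using trichotomy by blast
    then show "\<exists>as. (\<forall>b\<in>set as. strong_atom b) \<and> f = prod_list as"
    proof cases
      case 2
      then obtain a b where "strong_atom a" "strong_atom b" "f = a * b" using case2 by blast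
      then show ?thesis by (intro exI[of _ "[a, b]"]) simp
    qed (use f case1 case3 in blast)+
  qed
  have not_atomic: "\<not> atomic TYPE('k trunc_ring)"
    using assms by (intro not_atomic_trunc_ring) simp_all
  show ?thesis
    unfolding Let_def
    by (intro conjI allI impI; (elim conjE)?;
        (rule not_atomic strongly_atomic | (rule case1 case2 case3; assumption) | auto simp: trichotomy))
qed

end
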